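(* Let $M$ be a transversal matroid of rank $r$. If the presentations $\mathcal{A}=(A_i:i\in[r])$ and $\mathcal{B}=(B_i:i\in[r])$ of $M$ differ by more than just reindexing the sets (i.e. there is no permutation $\tau$ of $[r]$ with $B_i=A_{\tau(i)}$ for all $i$), then $|T_\mathcal{A}\cap T_\mathcal{B}|\le\frac34\cdot2^r$. This bound is sharp (there exist such $M$, $\mathcal{A}$, $\mathcal{B}$ attaining equality).
   Context: $[r]=\{1,\dots,r\}$. For a set system $\mathcal{A}=(A_i:i\in[r])$ on a finite set $E$, $M[\mathcal{A}]$ is the transversal matroid on $E$ whose independent sets are the partial transversals of $\mathcal{A}$ (sets $X$ admitting an injection $\phi:X\to[r]$ with $e\in A_{\phi(e)}$); $\mathcal{A}$ is a presentation of $M[\mathcal{A}]$; presentations of a rank-$r$ matroid have exactly $r$ sets. Fix $x\notin E$; for $I\subseteq[r]$, $\mathcal{A}^I$ is obtained from $\mathcal{A}$ by replacing $A_i$ by $A_i\cup\{x\}$ for each $i\in I$. $T_\mathcal{A}=\{M[\mathcal{A}^I]: I\subseteq[r]\}$ is the set of distinct single-element extensions of $M$ (matroids on $E\cup\{x\}$) obtained by extending $\mathcal{A}$; similarly $T_\mathcal{B}$. *)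

theory Defs
  imports Complex_Main "HOL-Combinatorics.Permutations"
begin

datatype 'a indep_system = Indep_System (ground: "'a set") (indeps: "'a set set")

definition matroid :: "'a indep_system \<Rightarrow> bool" where
  "matroid M \<longleftrightarrow>
     finite (ground M) \<and>
     (\<forall>X\<in>indeps M. X \<subseteq> ground M) \<and>
     {} \<in> indeps M \<and>
     (\<forall>X\<in>indeps M. \<forall>Y. Y \<subseteq> X \<longrightarrow> Y \<in> indeps M) \<and>
     (\<forall>X\<in>indeps M. \<forall>Y\<in>indeps M. card X < card Y \<longrightarrow> (\<exists>y\<in>Y - X. insert y X \<in> indeps M))"

definition matroid_rank :: "'a indep_system \<Rightarrow> nat" where
  "matroid_rank M = Max (card ` indeps M)"

text \<open>A set system \<open>(A\<^sub>i : i \<in> [r])\<close> is given by \<open>r\<close> and a function \<open>A\<close> on \<open>nat\<close>, of which only the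
  values on \<open>{1..r}\<close> are used.\<close>

definition partial_transversal :: "nat \<Rightarrow> (nat \<Rightarrow> 'a set) \<Rightarrow> 'a set \<Rightarrow> bool" where
  "partial_transversal r A X \<longleftrightarrow>
     (\<exists>\<phi>. inj_on \<phi> X \<and> \<phi> ` X \<subseteq> {1..r} \<and> (\<forall>e\<in>X. e \<in> A (\<phi> e)))"

definition transversal_system :: "'a set \<Rightarrow> nat \<Rightarrow> (nat \<Rightarrow> 'a set) \<Rightarrow> 'a indep_system" where
  "transversal_system E r A = Indep_System E {X. X \<subseteq> E \<and> partial_transversal r A X}"

definition presents :: "nat \<Rightarrow> (nat \<Rightarrow> 'a set) \<Rightarrow> 'a indep_system \<Rightarrow> bool" where
  "presents r A M \<longleftrightarrow>
     (\<forall>i\<in>{1..r}. A i \<subseteq> ground M) \<and> M = transversal_system (ground M) r A"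

definition transversal_matroid :: "'a indep_system \<Rightarrow> bool" where
  "transversal_matroid M \<longleftrightarrow> matroid M \<and> (\<exists>k A. presents k A M)"

definition extend_system :: "'a \<Rightarrow> nat set \<Rightarrow> (nat \<Rightarrow> 'a set) \<Rightarrow> nat \<Rightarrow> 'a set" where
  "extend_system x I A = (\<lambda>i. if i \<in> I then insert x (A i) else A i)"

definition extensions ::
  "'a set \<Rightarrow> 'a \<Rightarrow> nat \<Rightarrow> (nat \<Rightarrow> 'a set) \<Rightarrow> 'a indep_system set" where
  "extensions E x r A =
     {transversal_system (insert x E) r (extend_system x I A) | I. I \<subseteq> {1..r}}"

definition same_up_to_reindexing :: "nat \<Rightarrow> (nat \<Rightarrow> 'a set) \<Rightarrow> (nat \<Rightarrow> 'a set) \<Rightarrow> bool" where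
  "same_up_to_reindexing r A B \<longleftrightarrow>
     (\<exists>\<tau>. \<tau> permutes {1..r} \<and> (\<forall>i\<in>{1..r}. B i = A (\<tau> i)))"

end

theory Submission imports Defs begin

text \<open>
  Call an index \<open>i\<close> avoidable for a set \<open>X\<close> if \<open>X\<close> can be matched into the sets other than
  \<open>A\<^sub>i\<close>. Then \<open>X \<union> {x}\<close> is independent in \<open>M[\<A>\<^sup>I]\<close> iff some index of \<open>I\<close> is avoidable.

  Suppose that \<open>T\<^sub>\<A> \<inter> T\<^sub>\<B>\<close> has more than \<open>3/4 \<cdot> 2\<^sup>r\<close> members. If for some \<open>i \<noteq> j\<close> avoidability of
  \<open>i\<close> implied that of \<open>j\<close>, then adding \<open>i\<close> to a set \<open>I\<close> containing \<open>j\<close> would not change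
  \<open>M[\<A>\<^sup>I]\<close>, and a quarter of the sets \<open>I\<close> would be redundant. So this never happens, and an
  alternating path argument gives, for every \<open>i\<close>, an independent \<open>X\<close> of size \<open>r - 1\<close> for which
  \<open>i\<close> is the only avoidable index. If two indices were avoidable for \<open>X\<close> with respect to \<open>\<B>\<close>,
  then at most \<open>1/4 \<cdot> 2\<^sup>r\<close> members of \<open>T\<^sub>\<B>\<close> would make \<open>X \<union> {x}\<close> dependent, while only
  \<open>1/2 \<cdot> 2\<^sup>r\<close> members of \<open>T\<^sub>\<A>\<close> make it independent. Hence a single \<open>j\<close> is avoidable for \<open>X\<close> with
  respect to \<open>\<B>\<close>, and \<open>A\<^sub>i\<close> and \<open>B\<^sub>j\<close> are both the complement of the hyperplane spanned by \<open>X\<close>.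
\<close>

section \<open>Matchings into subfamilies and systems of representatives\<close>

definition matchable :: "(nat \<Rightarrow> 'a set) \<Rightarrow> nat set \<Rightarrow> 'a set \<Rightarrow> bool" where
  "matchable A K X \<longleftrightarrow> (\<exists>\<phi>. inj_on \<phi> X \<and> \<phi> ` X \<subseteq> K \<and> (\<forall>e\<in>X. e \<in> A (\<phi> e)))"

text \<open>A matching read from the index side, with every index of \<open>K\<close> used. Exchange
  arguments become updates of \<open>t\<close> at a single index.\<close>

definition representatives :: "(nat \<Rightarrow> 'a set) \<Rightarrow> nat set \<Rightarrow> (nat \<Rightarrow> 'a) \<Rightarrow> bool" where
  "representatives A K t \<longleftrightarrow> inj_on t K \<and> (\<forall>k\<in>K. t k \<in> A k)"

definition avoidable :: "nat \<Rightarrow> (nat \<Rightarrow> 'a set) \<Rightarrow> 'a set \<Rightarrow> nat set" where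
  "avoidable r A X = {i\<in>{1..r}. matchable A ({1..r} - {i}) X}"

text \<open>Says that the complement of \<open>\<Union>k\<in>R. A k\<close> has the largest rank \<open>r - |R|\<close> that it can have.\<close>

definition tight :: "nat \<Rightarrow> (nat \<Rightarrow> 'a set) \<Rightarrow> nat set \<Rightarrow> bool" where
  "tight r A R \<longleftrightarrow>
     (\<exists>t. representatives A ({1..r} - R) t \<and> (\<forall>l\<in>{1..r} - R. \<forall>k\<in>R. t l \<notin> A k))"

lemma partial_transversal_iff_matchable: "partial_transversal r A X \<longleftrightarrow> matchable A {1..r} X"
  by (simp add: partial_transversal_def matchable_def)

lemma matchable_mono:
  assumes "matchable A K X" "Y \<subseteq> X" "K \<subseteq> L"
  shows "matchable A L Y"
proof -
  obtain \<phi> where "inj_on \<phi> X" "\<phi> ` X \<subseteq> K" "\<forall>e\<in>X. e \<in> A (\<phi> e)"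
    using assms(1) by (auto simp: matchable_def)
  then show ?thesis
    unfolding matchable_def using assms(2,3) by (intro exI[of _ \<phi>]) (auto intro: inj_on_subset)
qed

lemma matchable_finite:
  assumes "matchable A K X" "finite K"
  shows "finite X"
  using assms unfolding matchable_def by (metis finite_subset finite_imageD)

lemma matchable_onto:
  assumes "inj_on \<phi> X" "\<phi> ` X \<subseteq> K" "finite K" "card X = card K"
  shows "\<phi> ` X = K"
  using assms by (metis card_image card_subset_eq)

lemma matchable_insert:
  assumes "matchable A K X" "e \<in> A k" "k \<notin> K" "e \<notin> X"
  shows "matchable A (insert k K) (insert e X)"
proof -
  obtain \<phi> where "inj_on \<phi> X" "\<phi> ` X \<subseteq> K" "\<forall>e\<in>X. e \<in> A (\<phi> e)"
    using assms(1) by (auto simp: matchable_def)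
  then show ?thesis
    unfolding matchable_def using assms(2-4)
    by (intro exI[of _ "\<phi>(e := k)"]) (auto simp: inj_on_def)
qed

lemma representatives_matchable:
  assumes "representatives A K t" "X \<subseteq> t ` K"
  shows "matchable A K X"
proof -
  have t: "inj_on t K" "\<forall>k\<in>K. t k \<in> A k"
    using assms(1) by (auto simp: representatives_def)
  show ?thesis
    unfolding matchable_def
  proof (intro exI[of _ "inv_into K t"] conjI ballI)
    show "inj_on (inv_into K t) X" by (rule inj_on_inv_into[OF assms(2)])
    show "inv_into K t ` X \<subseteq> K" using assms(2) by (auto intro: inv_into_into)
    fix e assume "e \<in> X"
    then show "e \<in> A (inv_into K t e)"
      using assms(2) t(2) by (metis f_inv_into_f inv_into_into subset_iff)
  qed
qed

lemma representatives_subset: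
  assumes "representatives A K t" "L \<subseteq> K"
  shows "representatives A L t"
  using assms by (auto simp: representatives_def intro: inj_on_subset)

lemma matchable_representatives:
  assumes "matchable A K X" "finite K" "card X = card K"
  obtains t where "representatives A K t" "t ` K = X"
proof -
  obtain \<phi> where \<phi>: "inj_on \<phi> X" "\<phi> ` X \<subseteq> K" "\<forall>e\<in>X. e \<in> A (\<phi> e)"
    using assms(1) by (auto simp: matchable_def)
  have "\<phi> ` X = K"
    using matchable_onto[OF \<phi>(1,2)] assms(2,3) by blast
  then have "representatives A K (inv_into X \<phi>)" "inv_into X \<phi> ` K = X"
    using \<phi> by (auto simp: representatives_def inj_on_inv_into)
  then show thesis by (rule that)
qed

text \<open>Choose a system of representatives that agrees as often as possible with a matching of
  \<open>X\<close>. If it missed an element of \<open>X\<close>, that element could replace the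
  representative of its matched index, which would increase the agreement.\<close>

lemma matchable_extend:
  assumes "finite K" "representatives A K t0" "matchable A K X"
  obtains t where "representatives A K t" "X \<subseteq> t ` K"
proof -
  obtain \<phi> where \<phi>: "inj_on \<phi> X" "\<phi> ` X \<subseteq> K" "\<forall>e\<in>X. e \<in> A (\<phi> e)"
    using assms(3) by (auto simp: matchable_def)
  have fin: "finite X" by (rule matchable_finite[OF assms(3,1)])
  define agree where "agree t = {e\<in>X. t (\<phi> e) = e}" for t :: "nat \<Rightarrow> 'a"
  have agree_sub: "agree t \<subseteq> X" for t by (simp add: agree_def)
  then have "card (agree t) < Suc (card X)" for t
    using fin by (simp add: card_mono less_Suc_eq_le)
  then obtain t where t: "representatives A K t"
    and max: "\<And>s. representatives A K s \<Longrightarrow> card (agree s) \<le> card (agree t)"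
    using ex_has_greatest_nat[of "representatives A K" t0 "\<lambda>t. card (agree t)" "Suc (card X)"] assms(2) by blast
  have "X \<subseteq> t ` K"
  proof
    fix e assume e: "e \<in> X"
    show "e \<in> t ` K"
    proof (rule ccontr)
      assume out: "e \<notin> t ` K"
      let ?s = "t(\<phi> e := e)"
      have "inj_on ?s K"
        using t out by (intro inj_on_fun_updI) (auto simp: representatives_def)
      moreover have "\<forall>k\<in>K. ?s k \<in> A k"
        using t \<phi>(3) e by (simp add: representatives_def)
      ultimately have "representatives A K ?s" by (simp add: representatives_def)
      moreover have "card (agree t) < card (agree ?s)"
      proof (rule psubset_card_mono)
        show "finite (agree ?s)" using fin agree_sub finite_subset by metis
        have "\<phi> e \<in> K" using e \<phi>(2) by auto
        then have "t (\<phi> e) \<noteq> e" using out by (metis imageI)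
        then have "e \<notin> agree t" "e \<in> agree ?s" using e by (simp_all add: agree_def)
        \<comment> \<open>By injectivity of \<open>\<phi>\<close> no other element of
          \<open>X\<close> has index \<open>\<phi> e\<close>, so the update destroys no
          agreement.\<close>
        moreover have "?s (\<phi> e') = e'" if "e' \<in> X" "t (\<phi> e') = e'" for e'
          using that inj_onD[OF \<phi>(1) _ that(1) e] by auto
        then have "agree t \<subseteq> agree ?s" by (simp add: agree_def subset_iff)
        ultimately show "agree t \<subset> agree ?s" by blast
      qed
      ultimately show False using max by (metis not_le)
    qed
  qed
  with t show thesis by (rule that)
qed

section \<open>Tight index sets and alternating paths\<close>

text \<open>Use \<open>t\<close> outside \<open>R\<close> and \<open>s\<close> on
  \<open>R - S\<close>. Their values do not collide, since \<open>s l\<close> lies in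
  \<open>A l\<close> with \<open>l\<close> in \<open>R\<close>, and the values of \<open>t\<close>
  avoid all such sets. Both kinds of values avoid the sets indexed by
  \<open>R \<inter> S\<close>.\<close>

lemma tight_Int:
  assumes "tight r A R" "tight r A S"
  shows "tight r A (R \<inter> S)"
proof -
  obtain t where t: "representatives A ({1..r} - R) t" "\<forall>l\<in>{1..r} - R. \<forall>k\<in>R. t l \<notin> A k"
    using assms(1) by (auto simp: tight_def)
  obtain s where s: "representatives A ({1..r} - S) s" "\<forall>l\<in>{1..r} - S. \<forall>k\<in>S. s l \<notin> A k"
    using assms(2) by (auto simp: tight_def)
  let ?u = "\<lambda>l. if l \<in> R then s l else t l"
  have apart: "s l \<noteq> t m" if "l \<in> {1..r} - S" "l \<in> R" "m \<in> {1..r} - R" for l m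
    using s(1) t(2) that unfolding representatives_def by metis
  have "inj_on ?u ({1..r} - R \<inter> S)"
  proof (rule inj_onI)
    fix l m assume "l \<in> {1..r} - R \<inter> S" "m \<in> {1..r} - R \<inter> S" "?u l = ?u m"
    then show "l = m"
      using apart[of l m] apart[of m l] inj_onD[of s "{1..r} - S" l m] inj_onD[of t "{1..r} - R" l m]
        s(1) t(1) by (auto simp: representatives_def split: if_splits)
  qed
  then show ?thesis
    unfolding tight_def using s t
    by (intro exI[of _ ?u]) (auto simp: representatives_def)
qed

lemma tight_separating:
  assumes i: "i \<in> {1..r}" and t: "representatives A ({1..r} - {i}) t"
    and j: "j \<notin> avoidable r A (t ` ({1..r} - {i}))"
  obtains R where "tight r A R" "i \<in> R" "j \<notin> R"
proof -
  define X where "X = t ` ({1..r} - {i})"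
  define reached where "reached R \<longleftrightarrow> i \<in> R \<and> R \<subseteq> {1..r} \<and>
    (\<forall>k\<in>R. \<exists>s. representatives A ({1..r} - {k}) s \<and> s ` ({1..r} - {k}) = X \<and>
      (\<forall>l\<in>{1..r} - R. s l = t l))" for R
  have "reached {i}"
    using i t by (auto simp: reached_def X_def)
  moreover have "card R < Suc r" if "reached R" for R
    using that card_mono[of "{1..r}" R] by (auto simp: reached_def)
  ultimately obtain R where R: "reached R" and max: "\<And>S. reached S \<Longrightarrow> card S \<le> card R"
    using ex_has_greatest_nat[of reached "{i}" card "Suc r"] by blast
  have iR: "i \<in> R" and sub: "R \<subseteq> {1..r}" using R by (auto simp: reached_def)
  have "t l \<notin> A k" if l: "l \<in> {1..r} - R" and k: "k \<in> R" for l k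
  proof
    assume tl: "t l \<in> A k"
    obtain s where s: "representatives A ({1..r} - {k}) s" "s ` ({1..r} - {k}) = X"
      "\<forall>l\<in>{1..r} - R. s l = t l"
      using R k by (auto simp: reached_def)
    have lk: "l \<noteq> k" "s l = t l" using l k s(3) by auto
    let ?s = "s(k := s l)"
    have inj: "inj_on s ({1..r} - {k})" using s(1) by (simp add: representatives_def)
    have "representatives A ({1..r} - {l}) ?s"
      unfolding representatives_def
    proof
      show "inj_on ?s ({1..r} - {l})"
      proof (rule inj_onI)
        fix m n assume "m \<in> {1..r} - {l}" "n \<in> {1..r} - {l}" "?s m = ?s n"
        then show "m = n"
          using inj_onD[OF inj, of m n] inj_onD[OF inj, of l n] inj_onD[OF inj, of m l] l lk(1)
          by (auto split: if_splits)
      qed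
      show "\<forall>m\<in>{1..r} - {l}. ?s m \<in> A m"
        using s(1) tl lk by (auto simp: representatives_def)
    qed
    moreover have "?s ` ({1..r} - {l}) = X"
    proof -
      have "?s ` ({1..r} - {l}) = insert (s l) (s ` ({1..r} - {l} - {k}))"
        using k sub lk by (auto simp: image_iff)
      also have "\<dots> = s ` ({1..r} - {k})"
        using l lk(1) by blast
      finally show ?thesis using s(2) by simp
    qed
    moreover have "\<forall>m\<in>{1..r} - insert l R. ?s m = t m"
      using s(3) k by auto
    ultimately have "\<exists>s. representatives A ({1..r} - {l}) s \<and> s ` ({1..r} - {l}) = X \<and>
        (\<forall>m\<in>{1..r} - insert l R. s m = t m)"
      by blast
    moreover have "\<exists>s. representatives A ({1..r} - {m}) s \<and> s ` ({1..r} - {m}) = X \<and>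
        (\<forall>n\<in>{1..r} - insert l R. s n = t n)" if "m \<in> R" for m
      using R that unfolding reached_def by (meson DiffD1 DiffD2 DiffI insertCI)
    ultimately have "reached (insert l R)"
      using iR sub l unfolding reached_def by simp
    then have "card (insert l R) \<le> card R" by (rule max)
    moreover have "finite R" using sub finite_subset by blast
    ultimately show False using l by simp
  qed
  moreover have "representatives A ({1..r} - R) t"
    by (rule representatives_subset[OF t]) (use iR in blast)
  ultimately have "tight r A R" by (auto simp: tight_def)
  moreover have "j \<notin> R"
  proof
    assume "j \<in> R"
    then obtain s where "representatives A ({1..r} - {j}) s" "s ` ({1..r} - {j}) = X"
      using R by (auto simp: reached_def)
    then have "matchable A ({1..r} - {j}) X"
      by (metis representatives_matchable order_refl)
    then show False
      using j \<open>j \<in> R\<close> sub by (auto simp: avoidable_def X_def)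
  qed
  ultimately show thesis using iR that by blast
qed

section \<open>Sets with a single avoidable index\<close>

lemma avoidable_antimono:
  assumes "Y \<subseteq> X"
  shows "avoidable r A X \<subseteq> avoidable r A Y"
  using assms by (auto simp: avoidable_def intro: matchable_mono)

text \<open>Each \<open>j\<close> other than \<open>i\<close> yields a tight set containing
  \<open>i\<close> but not \<open>j\<close>, and intersecting these shows that \<open>{i}\<close> is
  tight. The resulting representatives of the other indices avoid \<open>A i\<close>. A matching of
  these \<open>r - 1\<close> elements into all indices but \<open>k\<close> uses each of them and
  never uses \<open>i\<close>, so \<open>k = i\<close>.\<close>

lemma ex_unique_avoidable:
  assumes i: "i \<in> {1..r}" and AE: "\<forall>k\<in>{1..r}. A k \<subseteq> E"
    and t0: "representatives A {1..r} t0"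
    and sep: "\<And>j. j \<in> {1..r} \<Longrightarrow> j \<noteq> i \<Longrightarrow>
      \<exists>X\<subseteq>E. i \<in> avoidable r A X \<and> j \<notin> avoidable r A X"
  obtains X where "X \<subseteq> E" "card X = r - 1" "avoidable r A X = {i}"
proof -
  have ex: "\<exists>R. tight r A R \<and> i \<in> R \<and> j \<notin> R" if j: "j \<in> {1..r} - {i}" for j
  proof -
    obtain X where X: "i \<in> avoidable r A X" "j \<notin> avoidable r A X"
      using sep[of j] j by auto
    have "representatives A ({1..r} - {i}) t0"
      by (rule representatives_subset[OF t0]) blast
    \<comment> \<open>Enlarging the separating set to \<open>r - 1\<close> elements keeps
      \<open>j\<close> unavoidable, because larger sets have fewer avoidable indices.\<close>
    then obtain t where t: "representatives A ({1..r} - {i}) t" "X \<subseteq> t ` ({1..r} - {i})"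
      using matchable_extend[of "{1..r} - {i}" A t0 X] X(1) by (auto simp: avoidable_def)
    have "j \<notin> avoidable r A (t ` ({1..r} - {i}))"
      using avoidable_antimono[OF t(2)] X(2) by blast
    then show ?thesis
      using tight_separating[OF i t(1)] by metis
  qed
  have "\<exists>R. tight r A R \<and> i \<in> R \<and> R \<inter> J = {} \<and> R \<subseteq> {1..r}"
    if "finite J" "J \<subseteq> {1..r} - {i}" for J
    using that
  proof (induction J rule: finite_induct)
    case empty
    \<comment> \<open>Starting the intersection from all of \<open>{1..r}\<close>, which is
      vacuously tight, ensures that excluding every \<open>j \<noteq> i\<close> leaves exactly
      \<open>{i}\<close>.\<close>
    have "tight r A {1..r}" by (simp add: tight_def representatives_def)
    then show ?case using i by blast
  next
    case (insert j J)
    then obtain R where "tight r A R" "i \<in> R" "R \<inter> J = {}" "R \<subseteq> {1..r}" by auto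
    moreover obtain S where "tight r A S" "i \<in> S" "j \<notin> S" using ex[of j] insert.prems by auto
    ultimately show ?case
      using tight_Int[of r A R S] by (intro exI[of _ "R \<inter> S"]) auto
  qed
  from this[of "{1..r} - {i}"] obtain R where "tight r A R" "i \<in> R" "R \<inter> ({1..r} - {i}) = {}"
    "R \<subseteq> {1..r}" by auto
  moreover from this have "R = {i}" by auto
  ultimately obtain t where t: "representatives A ({1..r} - {i}) t"
    and out: "\<forall>l\<in>{1..r} - {i}. t l \<notin> A i"
    by (auto simp: tight_def)
  let ?X = "t ` ({1..r} - {i})"
  have "?X \<subseteq> E" using t AE by (auto simp: representatives_def)
  moreover have card: "card ?X = r - 1"
    using t i by (simp add: representatives_def card_image)
  moreover have "avoidable r A ?X = {i}"
  proof
    show "{i} \<subseteq> avoidable r A ?X"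
      using i representatives_matchable[OF t order_refl] by (simp add: avoidable_def)
    show "avoidable r A ?X \<subseteq> {i}"
    proof
      fix k assume k: "k \<in> avoidable r A ?X"
      then obtain \<phi> where \<phi>: "inj_on \<phi> ?X" "\<phi> ` ?X \<subseteq> {1..r} - {k}" "\<forall>e\<in>?X. e \<in> A (\<phi> e)"
        by (auto simp: avoidable_def matchable_def)
      have "\<phi> ` ?X = {1..r} - {k}"
        using matchable_onto[OF \<phi>(1,2)] card k by (simp add: avoidable_def)
      moreover have "i \<notin> \<phi> ` ?X" using \<phi>(3) out by auto
      ultimately show "k \<in> {i}" using i by auto
    qed
  qed
  ultimately show thesis by (rule that)
qed

lemma avoidable_nonempty:
  assumes "matchable A {1..r} X" "card X = r - 1" "1 \<le> r"
  shows "avoidable r A X \<noteq> {}"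
proof -
  obtain \<phi> where \<phi>: "inj_on \<phi> X" "\<phi> ` X \<subseteq> {1..r}" "\<forall>e\<in>X. e \<in> A (\<phi> e)"
    using assms(1) by (auto simp: matchable_def)
  \<comment> \<open>Subtraction is truncated; \<open>1 \<le> r\<close> is what makes
    \<open>r - 1\<close> differ from \<open>r\<close>.\<close>
  have "card (\<phi> ` X) \<noteq> card {1..r}" using \<phi>(1) assms(2,3) by (simp add: card_image)
  then obtain i where i: "i \<in> {1..r}" "i \<notin> \<phi> ` X" using \<phi>(2) by (metis subset_antisym subsetI)
  then have "\<phi> ` X \<subseteq> {1..r} - {i}" using \<phi>(2) by (simp add: subset_Diff_insert)
  then have "matchable A ({1..r} - {i}) X"
    unfolding matchable_def using \<phi>(1,3) by (intro exI[of _ \<phi>] conjI)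
  then show ?thesis using i(1) by (auto simp: avoidable_def)
qed

text \<open>\<open>X\<close> is disjoint from \<open>A i\<close>, since otherwise one of its
  elements could move to index \<open>i\<close> and make its old index avoidable. So elements of
  \<open>A i\<close> extend \<open>X\<close> through index \<open>i\<close>; conversely a matching
  of \<open>r\<close> elements uses every index, and only the added element can take
  \<open>i\<close>. The right-hand side depends only on independent sets, hence not on the
  presentation.\<close>

lemma unique_avoidable_determines_set:
  assumes "avoidable r A X = {i}" "card X = r - 1" "A i \<subseteq> E"
  shows "A i = {e\<in>E. e \<notin> X \<and> matchable A {1..r} (insert e X)}"
proof -
  have i: "i \<in> {1..r}" and m: "matchable A ({1..r} - {i}) X"
    using assms(1) by (auto simp: avoidable_def)
  obtain \<phi> where \<phi>: "inj_on \<phi> X" "\<phi> ` X \<subseteq> {1..r} - {i}" "\<forall>e\<in>X. e \<in> A (\<phi> e)"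
    using m by (auto simp: matchable_def)
  have disj: "e \<notin> A i" if e: "e \<in> X" for e
  proof
    assume "e \<in> A i"
    then have "matchable A ({1..r} - {\<phi> e}) X"
      unfolding matchable_def using \<phi> e i
      by (intro exI[of _ "\<phi>(e := i)"]) (auto simp: inj_on_def)
    then have "\<phi> e \<in> avoidable r A X" using \<phi>(2) e by (auto simp: avoidable_def)
    then show False using assms(1) \<phi>(2) e by auto
  qed
  show ?thesis
  proof (intro equalityI subsetI)
    fix e assume e: "e \<in> A i"
    have "matchable A (insert i ({1..r} - {i})) (insert e X)"
      by (rule matchable_insert[OF m e]) (use disj e in auto)
    then show "e \<in> {e\<in>E. e \<notin> X \<and> matchable A {1..r} (insert e X)}"
      using e disj assms(3) i by (auto simp: insert_absorb)
  next
    fix e assume e: "e \<in> {e\<in>E. e \<notin> X \<and> matchable A {1..r} (insert e X)}"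
    then obtain \<psi> where \<psi>: "inj_on \<psi> (insert e X)" "\<psi> ` insert e X \<subseteq> {1..r}"
      "\<forall>e'\<in>insert e X. e' \<in> A (\<psi> e')"
      by (auto simp: matchable_def)
    have "finite X" by (rule matchable_finite[OF m]) simp
    then have "card (insert e X) = card {1..r}" using e assms(2) i by auto
    then have "\<psi> ` insert e X = {1..r}" using matchable_onto[OF \<psi>(1,2)] by simp
    then obtain e' where "e' \<in> insert e X" "\<psi> e' = i" using i by (metis imageE)
    then show "e \<in> A i" using \<psi>(3) disj by auto
  qed
qed

section \<open>Independent sets of the extensions\<close>

text \<open>No \<open>A i\<close> contains \<open>x\<close>, so a matching must send
  \<open>x\<close> to an index of \<open>I\<close>, and its restriction to \<open>X\<close> avoids
  that index. Conversely, an avoidable index of \<open>I\<close> can be left free for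
  \<open>x\<close>.\<close>

lemma partial_transversal_extend_insert:
  assumes "x \<notin> X" "\<forall>i\<in>{1..r}. x \<notin> A i" "I \<subseteq> {1..r}"
  shows "partial_transversal r (extend_system x I A) (insert x X) \<longleftrightarrow> I \<inter> avoidable r A X \<noteq> {}"
proof
  assume "partial_transversal r (extend_system x I A) (insert x X)"
  then obtain \<phi> where \<phi>: "inj_on \<phi> (insert x X)" "\<phi> ` insert x X \<subseteq> {1..r}"
    "\<forall>e\<in>insert x X. e \<in> extend_system x I A (\<phi> e)"
    by (auto simp: partial_transversal_def)
  have "\<phi> x \<in> I"
    using \<phi>(2,3) assms(2) by (auto simp: extend_system_def split: if_splits)
  moreover have "matchable A ({1..r} - {\<phi> x}) X"
    unfolding matchable_def
  proof (intro exI[of _ \<phi>] conjI ballI)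
    show "inj_on \<phi> X" using \<phi>(1) by simp
    show "\<phi> ` X \<subseteq> {1..r} - {\<phi> x}" using \<phi>(1,2) assms(1) by (auto simp: inj_on_def)
    show "e \<in> A (\<phi> e)" if "e \<in> X" for e
      using \<phi>(3) that assms(1) by (auto simp: extend_system_def split: if_splits)
  qed
  ultimately have "\<phi> x \<in> I \<inter> avoidable r A X"
    using assms(3) by (simp add: avoidable_def subset_iff)
  then show "I \<inter> avoidable r A X \<noteq> {}" by (metis empty_iff)
next
  assume "I \<inter> avoidable r A X \<noteq> {}"
  then obtain i where i: "i \<in> I" "i \<in> {1..r}" and m: "matchable A ({1..r} - {i}) X"
    by (auto simp: avoidable_def)
  have "matchable (extend_system x I A) ({1..r} - {i}) X"
    using m unfolding matchable_def extend_system_def by (metis insertI2)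
  then have "matchable (extend_system x I A) (insert i ({1..r} - {i})) (insert x X)"
    by (rule matchable_insert) (use i assms(1) in \<open>auto simp: extend_system_def\<close>)
  then show "partial_transversal r (extend_system x I A) (insert x X)"
    using i by (simp add: partial_transversal_iff_matchable insert_absorb)
qed

lemma partial_transversal_extend:
  assumes "x \<notin> X"
  shows "partial_transversal r (extend_system x I A) X \<longleftrightarrow> partial_transversal r A X"
proof -
  have "e \<in> extend_system x I A k \<longleftrightarrow> e \<in> A k" if "e \<in> X" for e k
    using that assms by (auto simp: extend_system_def)
  then show ?thesis unfolding partial_transversal_def by simp
qed

text \<open>Sets without \<open>x\<close> are unaffected by \<open>I\<close>; for sets with
  \<open>x\<close> it only matters whether \<open>I\<close> meets the avoidable indices.\<close>

lemma extension_eqI: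
  assumes "x \<notin> E" "\<forall>i\<in>{1..r}. A i \<subseteq> E" "I \<subseteq> {1..r}" "J \<subseteq> {1..r}"
    and "\<And>X. X \<subseteq> E \<Longrightarrow> I \<inter> avoidable r A X \<noteq> {} \<longleftrightarrow> J \<inter> avoidable r A X \<noteq> {}"
  shows "transversal_system (insert x E) r (extend_system x I A) =
    transversal_system (insert x E) r (extend_system x J A)"
proof -
  have "partial_transversal r (extend_system x I A) Z \<longleftrightarrow>
      partial_transversal r (extend_system x J A) Z" if Z: "Z \<subseteq> insert x E" for Z
  proof (cases "x \<in> Z")
    case True
    then obtain X where X: "Z = insert x X" "x \<notin> X" by (meson mk_disjoint_insert)
    then have "X \<subseteq> E" using Z by auto
    moreover have "\<forall>i\<in>{1..r}. x \<notin> A i" using assms(1,2) by blast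
    ultimately show ?thesis
      using X assms(3-5) by (simp add: partial_transversal_extend_insert)
  qed (simp add: partial_transversal_extend)
  then show ?thesis unfolding transversal_system_def by auto
qed

lemma insert_in_extension_iff:
  assumes "x \<notin> E" "\<forall>i\<in>{1..r}. A i \<subseteq> E" "I \<subseteq> {1..r}" "X \<subseteq> E"
  shows "insert x X \<in> indeps (transversal_system (insert x E) r (extend_system x I A)) \<longleftrightarrow>
    I \<inter> avoidable r A X \<noteq> {}"
proof -
  have "x \<notin> X" "\<forall>i\<in>{1..r}. x \<notin> A i" using assms by blast+
  then show ?thesis
    using assms(3,4) partial_transversal_extend_insert[of x X r A I]
    by (auto simp: transversal_system_def)
qed

section \<open>Counting extensions\<close>

lemma card_Pow_avoiding_pair:
  assumes "finite S" "i \<in> S" "j \<in> S" "i \<noteq> j"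
  shows "4 * card (Pow (S - {i, j})) = 2 ^ card S"
proof -
  have "card S = card (S - {i, j}) + 2"
    using assms card_mono[of S "{i, j}"] by (simp add: card_Diff_subset)
  then show ?thesis using assms(1) by (simp add: card_Pow power_add)
qed

lemma card_Pow_implication:
  assumes "finite S" "i \<in> S" "j \<in> S" "i \<noteq> j"
  shows "4 * card {I\<in>Pow S. j \<in> I \<longrightarrow> i \<in> I} = 3 * 2 ^ card S"
proof -
  \<comment> \<open>The sets containing \<open>j\<close> but not \<open>i\<close>, parametrised by
    what remains after removing \<open>j\<close>: a quarter of all subsets.\<close>
  let ?bad = "insert j ` Pow (S - {i, j})"
  have eq: "{I\<in>Pow S. j \<in> I \<longrightarrow> i \<in> I} = Pow S - ?bad"
  proof (intro equalityI subsetI)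
    fix I assume "I \<in> Pow S - ?bad"
    moreover have "I \<in> ?bad" if "I \<subseteq> S" "j \<in> I" "i \<notin> I"
      using that by (intro image_eqI[of _ _ "I - {j}"]) auto
    ultimately show "I \<in> {I\<in>Pow S. j \<in> I \<longrightarrow> i \<in> I}" by auto
  qed (use assms(4) in auto)
  have "inj_on (insert j) (Pow (S - {i, j}))"
    by (auto simp: inj_on_def)
  then have "4 * card ?bad = 2 ^ card S"
    using card_Pow_avoiding_pair[OF assms] by (simp only: card_image)
  moreover have "card (Pow S - ?bad) = 2 ^ card S - card ?bad"
    using assms(1,3) by (subst card_Diff_subset) (auto simp: card_Pow)
  ultimately show ?thesis unfolding eq by simp
qed

lemma extensions_eq_image:
  "extensions E x r A =
    (\<lambda>I. transversal_system (insert x E) r (extend_system x I A)) ` Pow {1..r}"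
  by (auto simp: extensions_def)

lemma finite_extensions: "finite (extensions E x r A)"
  by (simp add: extensions_eq_image)

text \<open>A set \<open>I\<close> with \<open>j\<close> in it can be enlarged by \<open>i\<close>
  without changing the extension, so the sets containing \<open>i\<close> whenever they contain
  \<open>j\<close> already produce everything.\<close>

lemma card_extensions_implied_avoidability:
  assumes x: "x \<notin> E" and AE: "\<forall>k\<in>{1..r}. A k \<subseteq> E" and ij: "i \<in> {1..r}" "j \<in> {1..r}" "i \<noteq> j"
    and imp: "\<And>X. X \<subseteq> E \<Longrightarrow> i \<in> avoidable r A X \<Longrightarrow> j \<in> avoidable r A X"
  shows "4 * card (extensions E x r A) \<le> 3 * 2 ^ r"
proof -
  let ?N = "\<lambda>I. transversal_system (insert x E) r (extend_system x I A)"
  let ?F = "{I\<in>Pow {1..r}. j \<in> I \<longrightarrow> i \<in> I}"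
  have "?N I \<in> ?N ` ?F" if I: "I \<subseteq> {1..r}" for I
  proof (cases "j \<in> I")
    case True
    have "?N I = ?N (insert i I)"
      by (rule extension_eqI[OF x AE I]) (use I ij True imp in auto)
    then show ?thesis using I ij by (intro image_eqI[of _ _ "insert i I"]) auto
  qed (use I in auto)
  then have "extensions E x r A \<subseteq> ?N ` ?F" by (auto simp: extensions_eq_image)
  then have "card (extensions E x r A) \<le> card (?N ` ?F)"
    by (intro card_mono) auto
  also have "\<dots> \<le> card ?F" by (intro card_image_le) auto
  finally show ?thesis using card_Pow_implication[of "{1..r}" i j] ij by simp
qed

text \<open>Suppose that \<open>j\<close> and \<open>k\<close> are both avoidable for
  \<open>X\<close> with respect to \<open>B\<close>. A common extension in which
  \<open>insert x X\<close> is independent comes from a set \<open>I\<close> containing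
  \<open>i\<close>, one half of all sets; any other comes from a set \<open>J\<close> missing
  \<open>j\<close> and \<open>k\<close>, one quarter. The sum contradicts
  \<open>big\<close>.\<close>

lemma avoidable_transfer_singleton:
  assumes x: "x \<notin> E" and AE: "\<forall>k\<in>{1..r}. A k \<subseteq> E" and BE: "\<forall>k\<in>{1..r}. B k \<subseteq> E"
    and X: "X \<subseteq> E" "avoidable r A X = {i}" "j \<in> avoidable r B X"
    and big: "3 * 2 ^ r < 4 * card (extensions E x r A \<inter> extensions E x r B)"
  shows "avoidable r B X = {j}"
proof (rule ccontr)
  assume "avoidable r B X \<noteq> {j}"
  then obtain k where k: "k \<in> avoidable r B X" "k \<noteq> j" using X(3) by auto
  have mem: "i \<in> {1..r}" "j \<in> {1..r}" "k \<in> {1..r}"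
    using X(2,3) k(1) by (auto simp: avoidable_def)
  let ?N = "\<lambda>A I. transversal_system (insert x E) r (extend_system x I A)"
  let ?T = "extensions E x r A \<inter> extensions E x r B"
  let ?P = "insert i ` Pow ({1..r} - {i})" and ?Q = "Pow ({1..r} - {j, k})"
  have "?T \<subseteq> ?N A ` ?P \<union> ?N B ` ?Q"
  proof
    fix N assume N: "N \<in> ?T"
    show "N \<in> ?N A ` ?P \<union> ?N B ` ?Q"
    proof (cases "insert x X \<in> indeps N")
      case True
      obtain I where I: "I \<subseteq> {1..r}" "N = ?N A I"
        using N by (auto simp: extensions_def)
      then have "i \<in> I"
        using True insert_in_extension_iff[OF x AE I(1) X(1)] X(2) by auto
      then have "I \<in> ?P" using I(1) by (intro image_eqI[of _ _ "I - {i}"]) auto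
      then show ?thesis using I(2) by blast
    next
      case False
      obtain J where J: "J \<subseteq> {1..r}" "N = ?N B J"
        using N by (auto simp: extensions_def)
      then have "J \<inter> avoidable r B X = {}"
        using False insert_in_extension_iff[OF x BE J(1) X(1)] by auto
      then have "J \<in> ?Q" using J(1) X(3) k(1) by auto
      then show ?thesis using J(2) by blast
    qed
  qed
  then have "card ?T \<le> card (?N A ` ?P \<union> ?N B ` ?Q)"
    by (intro card_mono) auto
  also have "\<dots> \<le> card (?N A ` ?P) + card (?N B ` ?Q)" by (rule card_Un_le)
  also have "\<dots> \<le> card (Pow ({1..r} - {i})) + card ?Q"
    by (intro add_mono card_image_le order_trans[OF card_image_le card_image_le]) auto
  finally have "4 * card ?T \<le> 4 * card (Pow ({1..r} - {i})) + 4 * card ?Q" by simp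
  moreover have "2 * card (Pow ({1..r} - {i})) = 2 ^ r"
    using mem(1) by (cases r) (auto simp: card_Pow)
  moreover have "4 * card ?Q = 2 ^ r"
    using card_Pow_avoiding_pair[of "{1..r}" j k] mem k(2) by simp
  ultimately show False using big by linarith
qed

section \<open>The upper bound: recovering one presentation from the other\<close>

lemma many_common_extensions_same:
  fixes A B :: "nat \<Rightarrow> 'a set"
  assumes x: "x \<notin> E" and AE: "\<forall>k\<in>{1..r}. A k \<subseteq> E" and BE: "\<forall>k\<in>{1..r}. B k \<subseteq> E"
    and eq: "\<And>X. X \<subseteq> E \<Longrightarrow> matchable A {1..r} X \<longleftrightarrow> matchable B {1..r} X"
    and basis: "Z \<subseteq> E" "matchable A {1..r} Z" "card Z = r"
    and big: "3 * 2 ^ r < 4 * card (extensions E x r A \<inter> extensions E x r B)"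
  shows "same_up_to_reindexing r A B"
proof -
  \<comment> \<open>A matching of \<open>r\<close> elements uses every index, so \<open>Z\<close>
    represents all the sets.\<close>
  obtain t0 where t0: "representatives A {1..r} t0"
    by (rule matchable_representatives[OF basis(2)]) (use basis(3) in simp_all)
  have cardA: "3 * 2 ^ r < 4 * card (extensions E x r A)"
    using big card_mono[OF finite_extensions[of E x r A], of "extensions E x r A \<inter> extensions E x r B"]
    by simp
  have witness: "\<exists>X\<subseteq>E. card X = r - 1 \<and> avoidable r A X = {i}" if i: "i \<in> {1..r}" for i
  proof -
    have sep: "\<exists>X\<subseteq>E. i \<in> avoidable r A X \<and> j \<notin> avoidable r A X"
      if "j \<in> {1..r}" "j \<noteq> i" for j
    proof (rule ccontr)
      assume "\<not> (\<exists>X\<subseteq>E. i \<in> avoidable r A X \<and> j \<notin> avoidable r A X)"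
      then have "4 * card (extensions E x r A) \<le> 3 * 2 ^ r"
        using card_extensions_implied_avoidability[OF x AE i that(1)] that(2) by blast
      then show False using cardA by simp
    qed
    show ?thesis
      using ex_unique_avoidable[OF i AE t0 sep] by metis
  qed
  have "\<exists>j\<in>{1..r}. A i = B j" if i: "i \<in> {1..r}" for i
  proof -
    obtain X where X: "X \<subseteq> E" "card X = r - 1" "avoidable r A X = {i}"
      using witness[OF i] by blast
    have "matchable A ({1..r} - {i}) X" using X(3) by (auto simp: avoidable_def)
    then have "matchable A {1..r} X" by (rule matchable_mono) auto
    then have "matchable B {1..r} X" using eq X(1) by simp
    then obtain j where j: "j \<in> avoidable r B X"
      using avoidable_nonempty[of B r X] X(2) i by auto
    then have B: "avoidable r B X = {j}"
      by (rule avoidable_transfer_singleton[OF x AE BE X(1,3) _ big])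
    have jr: "j \<in> {1..r}" using j by (auto simp: avoidable_def)
    \<comment> \<open>Both sets are given by the same formula in independent sets, on which the two
      presentations agree.\<close>
    have "A i = {e\<in>E. e \<notin> X \<and> matchable A {1..r} (insert e X)}"
      by (rule unique_avoidable_determines_set[OF X(3,2)]) (use AE i in blast)
    also have "\<dots> = {e\<in>E. e \<notin> X \<and> matchable B {1..r} (insert e X)}"
      using eq X(1) by (intro Collect_cong) auto
    also have "\<dots> = B j"
      by (rule unique_avoidable_determines_set[OF B X(2), symmetric]) (use BE jr in blast)
    finally show ?thesis using jr by blast
  qed
  then obtain \<sigma> where \<sigma>: "\<And>i. i \<in> {1..r} \<Longrightarrow> \<sigma> i \<in> {1..r} \<and> A i = B (\<sigma> i)" by metis
  \<comment> \<open>If \<open>A i = A k\<close> with \<open>i \<noteq> k\<close>, the representative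
    of \<open>k\<close> in the witness \<open>X\<close> for \<open>i\<close> would lie in
    \<open>A i\<close>, which is disjoint from \<open>X\<close>.\<close>
  have injA: "inj_on A {1..r}"
  proof (rule inj_onI)
    fix i k assume i: "i \<in> {1..r}" and k: "k \<in> {1..r}" and ik: "A i = A k"
    obtain X where X: "X \<subseteq> E" "card X = r - 1" "avoidable r A X = {i}"
      using witness[OF i] by blast
    have m: "matchable A ({1..r} - {i}) X" using X(3) by (auto simp: avoidable_def)
    then obtain t where t: "representatives A ({1..r} - {i}) t" "t ` ({1..r} - {i}) = X"
      using matchable_representatives[OF m] X(2) i by auto
    show "i = k"
    proof (rule ccontr)
      assume "i \<noteq> k"
      then have "t k \<in> A i" "t k \<in> X" using t k ik by (auto simp: representatives_def)
      moreover have "A i \<subseteq> E" using AE i by blast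
      ultimately show False using unique_avoidable_determines_set[OF X(3,2)] by blast
    qed
  qed
  have "inj_on \<sigma> {1..r}"
    using injA \<sigma> unfolding inj_on_def by metis
  moreover have "\<sigma> ` {1..r} \<subseteq> {1..r}" using \<sigma> by blast
  ultimately have bij: "bij_betw \<sigma> {1..r} {1..r}"
    by (simp add: bij_betw_def endo_inj_surj)
  \<comment> \<open>Reindexing asks for \<open>B\<close> in terms of \<open>A\<close>, hence the
    inverse of \<open>\<sigma>\<close>; being a permutation requires the identity outside
    \<open>{1..r}\<close>.\<close>
  define \<tau> where "\<tau> i = (if i \<in> {1..r} then inv_into {1..r} \<sigma> i else i)" for i
  have "bij_betw \<tau> {1..r} {1..r}"
    using bij_betw_inv_into[OF bij] by (rule bij_betw_cong[THEN iffD1, rotated]) (simp add: \<tau>_def)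
  then have "\<tau> permutes {1..r}"
    by (rule bij_imp_permutes) (simp only: \<tau>_def if_False)
  moreover have "B i = A (\<tau> i)" if i: "i \<in> {1..r}" for i
  proof -
    have "\<tau> i \<in> {1..r}" "\<sigma> (\<tau> i) = i"
      using i bij bij_betw_inv_into_right[OF bij i] bij_betwE[OF bij_betw_inv_into[OF bij]]
      by (auto simp: \<tau>_def)
    then show ?thesis using \<sigma>[of "\<tau> i"] by simp
  qed
  ultimately show ?thesis unfolding same_up_to_reindexing_def by blast
qed

lemma card_common_extensions_le:
  fixes M :: "'a indep_system"
  assumes "matroid M" "matroid_rank M = r" "presents r A M" "presents r B M"
    and "\<not> same_up_to_reindexing r A B" "x \<notin> ground M"
  shows "4 * card (extensions (ground M) x r A \<inter> extensions (ground M) x r B) \<le> 3 * 2 ^ r"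
proof (rule ccontr)
  assume big: "\<not> ?thesis"
  let ?E = "ground M"
  have ind: "X \<in> indeps M \<longleftrightarrow> X \<subseteq> ?E \<and> matchable C {1..r} X" if "presents r C M" for C X
  proof -
    have "M = transversal_system ?E r C" using that by (simp add: presents_def)
    then have "indeps M = {X. X \<subseteq> ?E \<and> partial_transversal r C X}"
      by (metis indep_system.sel(2) transversal_system_def)
    then show ?thesis by (simp add: partial_transversal_iff_matchable)
  qed
  have "indeps M \<subseteq> Pow ?E" "finite ?E" "{} \<in> indeps M"
    using assms(1) by (auto simp: matroid_def)
  then have "finite (card ` indeps M)" "card ` indeps M \<noteq> {}"
    by (meson finite_Pow_iff finite_imageI finite_subset, auto)
  \<comment> \<open>The maximum over a finite nonempty set is attained, so some independent set has
    \<open>r\<close> elements.\<close>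
  then have "r \<in> card ` indeps M"
    using Max_in assms(2) by (fastforce simp: matroid_rank_def)
  then obtain Z where Z: "Z \<in> indeps M" "card Z = r" by auto
  have "same_up_to_reindexing r A B"
  proof (rule many_common_extensions_same[OF assms(6)])
    show "\<forall>k\<in>{1..r}. A k \<subseteq> ?E" "\<forall>k\<in>{1..r}. B k \<subseteq> ?E"
      using assms(3,4) by (auto simp: presents_def)
    show "matchable A {1..r} X \<longleftrightarrow> matchable B {1..r} X" if "X \<subseteq> ?E" for X
      using ind[OF assms(3)] ind[OF assms(4)] that by blast
    show "Z \<subseteq> ?E" "matchable A {1..r} Z" using Z ind[OF assms(3)] by auto
  qed (use Z big in auto)
  then show False using assms(5) by contradiction
qed

section \<open>Sharpness of the bound\<close>

text \<open>Equality holds for the free matroid on \<open>{1..r}\<close>, with \<open>A\<^sub>i = {i}\<close>, and \<open>B\<close> obtained from \<open>A\<close> by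
  enlarging \<open>A\<^sub>1\<close> to \<open>{1, 2}\<close>: then \<open>\<A>\<^sup>I\<close> and \<open>\<B>\<^sup>I\<close> present the same matroid unless \<open>2 \<in> I\<close> and
  \<open>1 \<notin> I\<close>.\<close>

definition free_system :: "nat \<Rightarrow> nat indep_system" where
  "free_system r = Indep_System {1..r} (Pow {1..r})"

definition singletons :: "nat \<Rightarrow> nat set" where
  "singletons i = {i}"

definition enlarged_singletons :: "nat \<Rightarrow> nat set" where
  "enlarged_singletons i = (if i = 1 then {1, 2} else {i})"

lemma free_system_matroid: "matroid (free_system r)"
proof -
  have "\<exists>y\<in>Y - X. y \<in> {1..r}" if "X \<subseteq> {1..r}" "Y \<subseteq> {1..r}" "card X < card Y" for X Y
  proof -
    have "\<not> Y \<subseteq> X" using that by (metis card_mono finite_atLeastAtMost finite_subset not_le)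
    then show ?thesis using that by blast
  qed
  then show ?thesis by (auto simp: matroid_def free_system_def)
qed

lemma free_system_rank: "matroid_rank (free_system r) = r"
  unfolding matroid_rank_def free_system_def
proof (rule Max_eqI)
  show "r \<in> card ` indeps (Indep_System {1..r} (Pow {1..r}))"
    by (intro image_eqI[of _ _ "{1..r}"]) auto
  fix n assume "n \<in> card ` indeps (Indep_System {1..r} (Pow {1..r}))"
  then show "n \<le> r" using card_mono[of "{1..r}"] by fastforce
qed auto

lemma presents_free_system:
  assumes "\<forall>i\<in>{1..r}. i \<in> A i" "\<forall>i\<in>{1..r}. A i \<subseteq> {1..r}"
  shows "presents r A (free_system r)"
proof -
  have "partial_transversal r A X" if "X \<subseteq> {1..r}" for X
    unfolding partial_transversal_def using that assms(1) by (intro exI[of _ id]) auto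
  then show ?thesis
    using assms(2) by (auto simp: presents_def free_system_def transversal_system_def)
qed

text \<open>The enlarged family only adds the element 2 to the set with index 1. A matching that
  uses this incidence is repaired by exchanging the indices 1 and 2 throughout.\<close>

lemma extend_singletons_eq_enlarged:
  assumes r: "2 \<le> r" and I: "2 \<in> I \<longrightarrow> 1 \<in> I"
  shows "transversal_system E r (extend_system 0 I singletons) =
    transversal_system E r (extend_system 0 I enlarged_singletons)"
proof -
  have small: "e \<in> extend_system 0 I singletons k \<or> e = 2 \<and> k = 1"
    if "e \<in> extend_system 0 I enlarged_singletons k" for e k
    using that
    by (auto simp: extend_system_def singletons_def enlarged_singletons_def split: if_splits)
  have "partial_transversal r (extend_system 0 I singletons) X \<longleftrightarrow>
    partial_transversal r (extend_system 0 I enlarged_singletons) X" for X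
  proof
    assume "partial_transversal r (extend_system 0 I singletons) X"
    moreover have "extend_system 0 I singletons i \<subseteq> extend_system 0 I enlarged_singletons i" for i
      by (auto simp: extend_system_def singletons_def enlarged_singletons_def)
    ultimately show "partial_transversal r (extend_system 0 I enlarged_singletons) X"
      unfolding partial_transversal_def by blast
  next
    assume "partial_transversal r (extend_system 0 I enlarged_singletons) X"
    then obtain \<phi> where \<phi>: "inj_on \<phi> X" "\<phi> ` X \<subseteq> {1..r}"
      "\<forall>e\<in>X. e \<in> extend_system 0 I enlarged_singletons (\<phi> e)"
      by (auto simp: partial_transversal_def)
    show "partial_transversal r (extend_system 0 I singletons) X"
    proof (cases "2 \<in> X \<and> \<phi> 2 = 1")
      case False
      have "e \<in> extend_system 0 I singletons (\<phi> e)" if "e \<in> X" for e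
        using small[of e "\<phi> e"] \<phi>(3) that False by metis
      then show ?thesis unfolding partial_transversal_def using \<phi>(1,2) by blast
    next
      case True
      let ?\<psi> = "transpose 1 2 \<circ> \<phi>"
      have "inj_on ?\<psi> X"
        using \<phi>(1) by (intro comp_inj_on) (auto intro: inj_on_subset[OF inj_transpose])
      moreover have "?\<psi> ` X \<subseteq> {1..r}"
        using \<phi>(2) r by (auto simp: transpose_def)
      moreover have "e \<in> extend_system 0 I singletons (?\<psi> e)" if e: "e \<in> X" for e
      proof (cases "e = 2")
        case True
        then show ?thesis using \<open>2 \<in> X \<and> \<phi> 2 = 1\<close>
          by (simp add: extend_system_def singletons_def)
      next
        case False
        then have "\<phi> e \<noteq> 1" using \<phi>(1) e True by (metis inj_onD)
        \<comment> \<open>Only \<open>k = 2\<close> changes. An element other than 2 in that set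
          must be the new element 0, so \<open>2 \<in> I\<close>; then \<open>1 \<in> I\<close>, and
          0 also lies in the set with index 1.\<close>
        moreover have "e \<in> extend_system 0 I singletons k'"
          if "e \<in> extend_system 0 I singletons k" "k \<noteq> 1" "k' = transpose 1 2 k" for k k'
          using that False I
          by (cases "k = 2") (auto simp: extend_system_def singletons_def split: if_splits)
        moreover have "e \<in> extend_system 0 I singletons (\<phi> e)"
          using small[of e "\<phi> e"] \<phi>(3) e False by metis
        ultimately show ?thesis by (metis comp_apply)
      qed
      ultimately show ?thesis unfolding partial_transversal_def by blast
    qed
  qed
  then show ?thesis by (simp add: transversal_system_def)
qed

lemma avoidable_singletons:
  assumes "i \<in> {1..r}"
  shows "avoidable r singletons ({1..r} - {i}) = {i}"
proof (intro equalityI subsetI)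
  fix k assume "k \<in> avoidable r singletons ({1..r} - {i})"
  then obtain \<phi> where k: "k \<in> {1..r}" and \<phi>: "\<phi> ` ({1..r} - {i}) \<subseteq> {1..r} - {k}"
    "\<forall>e\<in>{1..r} - {i}. e = \<phi> e"
    by (auto simp: avoidable_def matchable_def singletons_def)
  then have "k \<notin> {1..r} - {i}" by (metis DiffD2 image_subset_iff singletonI)
  then show "k \<in> {i}" using k by simp
next
  fix k assume "k \<in> {i}"
  then show "k \<in> avoidable r singletons ({1..r} - {i})"
    using assms by (auto simp: avoidable_def matchable_def singletons_def intro!: exI[of _ id])
qed

text \<open>Three quarters of the sets \<open>I\<close> give common extensions, and these are
  distinct: \<open>i\<close> is the only avoidable index of \<open>{1..r} - {i}\<close>, so
  independence of this set together with 0 tells whether \<open>i \<in> I\<close>.\<close>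

lemma card_common_extensions_free_ge:
  assumes r: "2 \<le> r"
  shows "3 * 2 ^ r \<le> 4 * card (extensions {1..r} 0 r singletons \<inter> 
    extensions {1..r} 0 r enlarged_singletons)"
    (is "_ \<le> 4 * card ?T")
proof -
  let ?N = "\<lambda>I. transversal_system (insert 0 {1..r}) r (extend_system 0 I singletons)"
  let ?F = "{I\<in>Pow {1..r}. 2 \<in> I \<longrightarrow> 1 \<in> I}"
  have "?N I \<in> ?T" if "I \<in> ?F" for I
  proof
    show "?N I \<in> extensions {1..r} 0 r singletons"
      using that by (auto simp: extensions_eq_image)
    show "?N I \<in> extensions {1..r} 0 r enlarged_singletons"
      using that extend_singletons_eq_enlarged[OF r, of I] by (auto simp: extensions_eq_image)
  qed
  moreover have "inj_on ?N ?F"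
  proof (rule inj_onI)
    have mem: "i \<in> I \<longleftrightarrow> insert 0 ({1..r} - {i}) \<in> indeps (?N I)"
      if "I \<subseteq> {1..r}" "i \<in> {1..r}" for I i
      using insert_in_extension_iff[of 0 "{1..r}" r singletons I "{1..r} - {i}"]
        avoidable_singletons[OF that(2)] that by (auto simp: singletons_def)
    fix I J assume IJ: "I \<in> ?F" "J \<in> ?F" and eq: "?N I = ?N J"
    have "i \<in> I \<longleftrightarrow> i \<in> J" if "i \<in> {1..r}" for i
      using mem[of I i] mem[of J i] IJ that eq by auto
    then show "I = J" using IJ by auto
  qed
  moreover have "finite ?T" by (simp add: finite_extensions)
  ultimately have "card ?F \<le> card ?T"
    by (intro card_inj_on_le[of ?N] image_subsetI)
  then show ?thesis using card_Pow_implication[of "{1..r}" 1 2] r by simp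
qed

lemma not_same_singletons_enlarged:
  assumes "1 \<le> r"
  shows "\<not> same_up_to_reindexing r singletons enlarged_singletons"
proof
  assume "same_up_to_reindexing r singletons enlarged_singletons"
  then obtain \<tau> :: "nat \<Rightarrow> nat" where "enlarged_singletons 1 = singletons (\<tau> 1)"
    using assms by (auto simp: same_up_to_reindexing_def)
  then have "card (enlarged_singletons 1) = card (singletons (\<tau> 1))" by simp
  then show False by (simp add: enlarged_singletons_def singletons_def)
qed

lemma sharp_example:
  assumes r: "2 \<le> r"
  shows "\<exists>(M :: nat indep_system) A B x.
      transversal_matroid M \<and> matroid_rank M = r \<and>
      presents r A M \<and> presents r B M \<and>
      \<not> same_up_to_reindexing r A B \<and> x \<notin> ground M \<and>
      real (card (extensions (ground M) x r A \<inter> extensions (ground M) x r B)) = 3 / 4 * 2 ^ r"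
proof -
  let ?M = "free_system r"
  let ?c = "card (extensions (ground ?M) 0 r singletons \<inter> extensions (ground ?M) 0 r enlarged_singletons)"
  have A: "presents r singletons ?M" and B: "presents r enlarged_singletons ?M"
    using r by (auto intro!: presents_free_system simp: singletons_def enlarged_singletons_def split: if_splits)
  have g: "ground ?M = {1..r}" by (simp add: free_system_def)
  have ns: "\<not> same_up_to_reindexing r singletons enlarged_singletons"
    using not_same_singletons_enlarged r by simp
  have x: "0 \<notin> ground ?M" by (simp add: g)
  \<comment> \<open>The upper estimate is the general bound applied to this pair of
    presentations.\<close>
  have "4 * ?c = 3 * 2 ^ r"
    using card_common_extensions_le[OF free_system_matroid free_system_rank A B ns x]
      card_common_extensions_free_ge[OF r] unfolding g by (rule antisym)
  then have "4 * real ?c = 3 * 2 ^ r"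
    by (metis of_nat_mult of_nat_numeral of_nat_power)
  then have "real ?c = 3 / 4 * 2 ^ r" by simp
  moreover have "transversal_matroid ?M"
    using A free_system_matroid by (auto simp: transversal_matroid_def)
  ultimately show ?thesis using A B ns x free_system_rank by blast
qed

theorem theorem4p5:
  "(\<forall>(M :: 'a indep_system) r A B x.
      transversal_matroid M \<longrightarrow> matroid_rank M = r \<longrightarrow>
      presents r A M \<longrightarrow> presents r B M \<longrightarrow>
      \<not> same_up_to_reindexing r A B \<longrightarrow> x \<notin> ground M \<longrightarrow>
      real (card (extensions (ground M) x r A \<inter> extensions (ground M) x r B)) \<le> 3 / 4 * 2 ^ r)
   \<and>
   (\<forall>r\<ge>2. \<exists>(M :: nat indep_system) A B x.
      transversal_matroid M \<and> matroid_rank M = r \<and>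
      presents r A M \<and> presents r B M \<and>
      \<not> same_up_to_reindexing r A B \<and> x \<notin> ground M \<and>
      real (card (extensions (ground M) x r A \<inter> extensions (ground M) x r B)) = 3 / 4 * 2 ^ r)"
proof (intro conjI allI impI)
  fix M :: "'a indep_system" and r A B x
  assume "transversal_matroid M" "matroid_rank M = r" "presents r A M" "presents r B M"
    "\<not> same_up_to_reindexing r A B" "x \<notin> ground M"
  then have "4 * card (extensions (ground M) x r A \<inter> extensions (ground M) x r B) \<le> 3 * 2 ^ r"
    by (intro card_common_extensions_le) (auto simp: transversal_matroid_def)
  then have "real (4 * card (extensions (ground M) x r A \<inter> extensions (ground M) x r B)) \<le> real (3 * 2 ^ r)"
    by (rule of_nat_mono)
  then show "real (card (extensions (ground M) x r A \<inter> extensions (ground M) x r B)) \<le> 3 / 4 * 2 ^ r"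
    by simp
qed (rule sharp_example)

end
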